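(* Let $a, b \in \mathcal{B}(\mathbb{C}^2)$ be symmetric matrices (that is, $a^t = a$ and $b^t = b$, where $t$ denotes transpose), and let $T_{a,b}\colon \mathcal{B}(\mathbb{C}^2)\to\mathcal{B}(\mathbb{C}^2)$ be given by $T_{a,b}(x) = axb+bxa$. Then $$\left\| T_{a,b} \right\|_{cb} = \left\| T_{a,b} \right\| = \inf_{x > 0} \left\| x\, a a^* + \frac{1}{x}\, b b^* \right\|.$$
   Context: $\mathcal{B}(\mathbb{C}^2)$ is the algebra of complex $2\times 2$ matrices with the operator norm $\|\cdot\|$ (with respect to the Euclidean norm on $\mathbb{C}^2$); $a^*$ is the conjugate transpose (adjoint). In the infimum $x$ ranges over positive real numbers. $\|T\|$ is the norm of $T$ as a linear operator on $\mathcal{B}(\mathbb{C}^2)$ with the operator norm, and $\|T\|_{cb} = \sup_n \|T^{(n)}\|$ is the completely bounded norm, where $T^{(n)}$ applies $T$ entrywise to $n\times n$ matrices over $\mathcal{B}(\mathbb{C}^2)$, with $M_n(\mathcal{B}(\mathbb{C}^2))$ normed as $\mathcal{B}((\mathbb{C}^2)^n)$. *)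

theory Defs
  imports "HOL-Analysis.Analysis"
begin

definition conj_transpose :: "complex^'n^'m \<Rightarrow> complex^'m^'n" where
  "conj_transpose A = (\<chi> i j. cnj (A $ j $ i))"

(* The norm of the type complex^'n^'m is the Frobenius norm, so the operator norm is
   taken from onorm; the norm of complex^'n is the Euclidean one. *)
definition mat_opnorm :: "complex^'n^'m \<Rightarrow> real" where
  "mat_opnorm A = onorm (\<lambda>v. A *v v)"

(* Vectors of (C^k)^n are functions nat => complex^'k, and n x n matrices over B(C^k) are
   functions nat => nat => complex^'k^'k; only indices below n are looked at. *)
definition block_vec_norm :: "nat \<Rightarrow> (nat \<Rightarrow> complex^'k) \<Rightarrow> real" where
  "block_vec_norm n v = sqrt (\<Sum>i<n. (norm (v i))\<^sup>2)"

definition block_apply ::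
    "nat \<Rightarrow> (nat \<Rightarrow> nat \<Rightarrow> complex^'k^'k) \<Rightarrow> (nat \<Rightarrow> complex^'k) \<Rightarrow> nat \<Rightarrow> complex^'k" where
  "block_apply n X v = (\<lambda>i. \<Sum>j<n. X i j *v v j)"

definition block_opnorm :: "nat \<Rightarrow> (nat \<Rightarrow> nat \<Rightarrow> complex^'k^'k) \<Rightarrow> real" where
  "block_opnorm n X = (SUP v\<in>{v. block_vec_norm n v \<le> 1}. block_vec_norm n (block_apply n X v))"

definition ampliation ::
    "(complex^'k^'k \<Rightarrow> complex^'k^'k) \<Rightarrow> (nat \<Rightarrow> nat \<Rightarrow> complex^'k^'k) \<Rightarrow> nat \<Rightarrow> nat \<Rightarrow> complex^'k^'k" where
  "ampliation T X = (\<lambda>i j. T (X i j))"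

(* The suprema defining norms of maps are extended reals, so that an equation with a real
   number includes finiteness. *)
definition map_norm :: "(complex^'k^'k \<Rightarrow> complex^'k^'k) \<Rightarrow> ereal" where
  "map_norm T = (SUP x\<in>{x. mat_opnorm x \<le> 1}. ereal (mat_opnorm (T x)))"

definition ampliation_norm :: "nat \<Rightarrow> (complex^'k^'k \<Rightarrow> complex^'k^'k) \<Rightarrow> ereal" where
  "ampliation_norm n T =
     (SUP X\<in>{X. block_opnorm n X \<le> 1}. ereal (block_opnorm n (ampliation T X)))"

definition cb_norm :: "(complex^'k^'k \<Rightarrow> complex^'k^'k) \<Rightarrow> ereal" where
  "cb_norm T = (SUP n\<in>{1..}. ampliation_norm n T)"

definition elem_op :: "complex^'k^'k \<Rightarrow> complex^'k^'k \<Rightarrow> complex^'k^'k \<Rightarrow> complex^'k^'k" where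
  "elem_op a b x = a ** x ** b + b ** x ** a"

(* The supremum in block_opnorm is a real one, hence meaningful only because of this. *)
lemma bdd_above_block_opnorm:
  fixes X :: "nat \<Rightarrow> nat \<Rightarrow> complex^'k^'k"
  shows "bdd_above ((\<lambda>v. block_vec_norm n (block_apply n X v)) ` {v. block_vec_norm n v \<le> 1})"
proof (rule bdd_aboveI2)
  fix v :: "nat \<Rightarrow> complex^'k"
  assume "v \<in> {v. block_vec_norm n v \<le> 1}"
  then have le1: "(\<Sum>j<n. (norm (v j))\<^sup>2) \<le> 1"
    by (simp add: block_vec_norm_def)
  have v1: "norm (v j) \<le> 1" if "j < n" for j
  proof -
    have "(norm (v j))\<^sup>2 \<le> (\<Sum>j<n. (norm (v j))\<^sup>2)"
      using that by (intro member_le_sum) auto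
    with le1 have "(norm (v j))\<^sup>2 \<le> 1" by linarith
    then show ?thesis by (simp add: abs_square_le_1)
  qed
  have bl: "bounded_linear (\<lambda>w. X i j *v w)" for i j
    by (rule matrix_vector_mul_bounded_linear)
  have "norm (block_apply n X v i) \<le> (\<Sum>j<n. mat_opnorm (X i j))" for i
    unfolding block_apply_def
  proof (rule sum_norm_le)
    fix j assume "j \<in> {..<n}"
    have "norm (X i j *v v j) \<le> onorm (\<lambda>w. X i j *v w) * norm (v j)"
      by (rule onorm[OF bl])
    also have "\<dots> \<le> onorm (\<lambda>w. X i j *v w)"
      using v1 \<open>j \<in> {..<n}\<close> onorm_pos_le[OF bl] by (simp add: mult_left_le)
    finally show "norm (X i j *v v j) \<le> mat_opnorm (X i j)"
      by (simp add: mat_opnorm_def)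
  qed
  then have "(norm (block_apply n X v i))\<^sup>2 \<le> (\<Sum>j<n. mat_opnorm (X i j))\<^sup>2" for i
    by (intro power_mono) auto
  then show "block_vec_norm n (block_apply n X v) \<le> sqrt (\<Sum>i<n. (\<Sum>j<n. mat_opnorm (X i j))\<^sup>2)"
    unfolding block_vec_norm_def by (intro real_sqrt_le_mono sum_mono)
qed

end

theory Submission
  imports Defs
begin

text \<open>
  Write \<open>T(x)\<close> as the row \<open>(\<surd>s a, b/\<surd>s)\<close> times \<open>diag(x, x)\<close> times the column \<open>(b/\<surd>s, \<surd>s a)\<close>.
  For symmetric \<open>a\<close>, \<open>b\<close> entrywise conjugation exchanges \<open>a\<close> with \<open>a*\<close>, so row and column have the
  same norm, which gives the upper bound for the completely bounded norm. For the lower bound, let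
  \<open>m\<close> be positive and below the infimum. Every \<open>s > 0\<close> has a vector \<open>\<xi>\<close> with
  \<open>s |a*\<xi>|^2 + |b*\<xi>|^2 / s > m |\<xi>|^2\<close>; by connectedness, first of the half-line of
  all \<open>s\<close> and then of a segment of vectors, some such pair also has \<open>s |a*\<xi>| = |b*\<xi>|\<close>. With
  \<open>\<eta>\<close> the conjugate of \<open>\<xi>\<close>, \<open>u = s a\<eta>\<close> and \<open>v = b\<eta>\<close>, the pairs \<open>(u, v)\<close> and
  \<open>(cnj v, cnj u)\<close> have the same Gram matrix, so a contraction \<open>x\<close> maps the first to the second,
  and \<open>T(x)\<close> evaluated at \<open>\<eta>\<close> and \<open>\<xi>\<close> exceeds \<open>m |\<xi>|^2\<close>.
\<close>

section \<open>Balanced vectors for pairs of quadratic forms, by connectedness\<close>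

lemma norm_scaled_combination_sq:
  fixes x y :: "'a::real_inner"
  shows "(norm (p *\<^sub>R x + q *\<^sub>R y))\<^sup>2
    = p\<^sup>2 * (norm x)\<^sup>2 + 2 * p * q * (x \<bullet> y) + q\<^sup>2 * (norm y)\<^sup>2"
  unfolding power2_norm_eq_inner
  by (simp add: inner_add_left inner_add_right inner_commute distrib_left power2_eq_square)

text \<open>In the notation of the proof, \<open>F\<close> is a real quadratic form, positive at
  both endpoints. Once its cross term is made nonnegative by a choice of sign, it stays positive on
  the whole segment between them. The form \<open>G\<close> has opposite weak signs at the endpoints
  and so vanishes somewhere on that segment.\<close>

lemma balanced_vector_on_segment:
  fixes C D :: "'a::real_inner \<Rightarrow> 'b::real_inner"
  assumes C: "bounded_linear C" and D: "bounded_linear D"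
    and \<xi>: "k * (norm \<xi>)\<^sup>2 < r * (norm (C \<xi>))\<^sup>2 + (norm (D \<xi>))\<^sup>2"
      "(norm (D \<xi>))\<^sup>2 \<le> r * (norm (C \<xi>))\<^sup>2"
    and \<zeta>: "k * (norm \<zeta>)\<^sup>2 < r * (norm (C \<zeta>))\<^sup>2 + (norm (D \<zeta>))\<^sup>2"
      "r * (norm (C \<zeta>))\<^sup>2 \<le> (norm (D \<zeta>))\<^sup>2"
  shows "\<exists>\<omega>. k * (norm \<omega>)\<^sup>2 < r * (norm (C \<omega>))\<^sup>2 + (norm (D \<omega>))\<^sup>2
    \<and> r * (norm (C \<omega>))\<^sup>2 = (norm (D \<omega>))\<^sup>2"
proof -
  interpret C: bounded_linear C by (rule C)
  interpret D: bounded_linear D by (rule D)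
  define F where "F \<omega> = r * (norm (C \<omega>))\<^sup>2 + (norm (D \<omega>))\<^sup>2 - k * (norm \<omega>)\<^sup>2" for \<omega>
  define G where "G \<omega> = r * (norm (C \<omega>))\<^sup>2 - (norm (D \<omega>))\<^sup>2" for \<omega>
  define H where "H v w = r * (C v \<bullet> C w) + D v \<bullet> D w - k * (v \<bullet> w)" for v w
  \<comment> \<open>\<open>H\<close> is the polar form of \<open>F\<close>. Replacing
    \<open>\<zeta>\<close> by its negative flips the sign of \<open>H\<close> and leaves the even
    functions \<open>F\<close> and \<open>G\<close> unchanged.\<close>
  have "\<exists>\<zeta>'. F \<zeta>' = F \<zeta> \<and> G \<zeta>' = G \<zeta> \<and> 0 \<le> H \<xi> \<zeta>'"
  proof (cases "0 \<le> H \<xi> \<zeta>")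
    case False
    then have "0 \<le> H \<xi> (- \<zeta>)"
      by (simp add: H_def C.neg D.neg)
    moreover have "F (- \<zeta>) = F \<zeta>" "G (- \<zeta>) = G \<zeta>"
      by (simp_all add: F_def G_def C.neg D.neg)
    ultimately show ?thesis by blast
  qed blast
  then obtain \<zeta>' where \<zeta>': "F \<zeta>' = F \<zeta>" "G \<zeta>' = G \<zeta>" "0 \<le> H \<xi> \<zeta>'" by blast
  define \<gamma> where "\<gamma> t = (1 - t) *\<^sub>R \<xi> + t *\<^sub>R \<zeta>'" for t :: real
  have C\<gamma>: "C (\<gamma> t) = (1 - t) *\<^sub>R C \<xi> + t *\<^sub>R C \<zeta>'"
    and D\<gamma>: "D (\<gamma> t) = (1 - t) *\<^sub>R D \<xi> + t *\<^sub>R D \<zeta>'" for t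
    by (simp_all add: \<gamma>_def C.add D.add C.scaleR D.scaleR)
  have F\<gamma>: "F (\<gamma> t) = (1 - t)\<^sup>2 * F \<xi> + 2 * t * (1 - t) * H \<xi> \<zeta>' + t\<^sup>2 * F \<zeta>'" for t
    unfolding F_def H_def C\<gamma> D\<gamma>
    unfolding \<gamma>_def norm_scaled_combination_sq by algebra
  have "continuous_on {0..1} (\<lambda>t. G (\<gamma> t))"
    unfolding G_def C\<gamma> D\<gamma> by (intro continuous_intros)
  moreover have "G (\<gamma> 1) \<le> 0" "0 \<le> G (\<gamma> 0)"
    using \<xi>(2) \<zeta>(2) \<zeta>'(2) by (simp_all add: \<gamma>_def G_def)
  ultimately obtain t where t: "0 \<le> t" "t \<le> 1" "G (\<gamma> t) = 0"
    using IVT2'[of "\<lambda>t. G (\<gamma> t)" 1 0 0] by auto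
  have pos: "0 < F \<xi>" "0 < F \<zeta>'"
    using \<xi>(1) \<zeta>(1) \<zeta>'(1) by (simp_all add: F_def)
  have "0 < (1 - t)\<^sup>2 * F \<xi> + t\<^sup>2 * F \<zeta>'"
  proof (cases "t = 0")
    case False
    then have "0 < t\<^sup>2 * F \<zeta>'" using pos by simp
    moreover have "0 \<le> (1 - t)\<^sup>2 * F \<xi>" using pos by simp
    ultimately show ?thesis by linarith
  qed (use pos in simp)
  moreover have "0 \<le> 2 * t * (1 - t) * H \<xi> \<zeta>'"
    using t \<zeta>'(3) by simp
  ultimately have "0 < F (\<gamma> t)" unfolding F\<gamma> by linarith
  with t(3) show ?thesis by (intro exI[of _ "\<gamma> t"]) (auto simp: F_def G_def)
qed

text \<open>If no balanced pair existed, the half-line would be covered by two disjoint open sets of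
  parameters, according to which of the terms in \<open>C\<close> and \<open>D\<close> dominates at
  some witness. Disjointness comes from the segment argument, so by connectedness one term would
  dominate for every parameter. Boundedness of \<open>D\<close> excludes this for a large parameter,
  and boundedness of \<open>C\<close> for a small one.\<close>

lemma exists_balanced_vector:
  fixes C D :: "'a::real_inner \<Rightarrow> 'b::real_inner"
  assumes C: "bounded_linear C" and D: "bounded_linear D" and "0 < m"
    and large: "\<And>s. 0 < s \<Longrightarrow>
      \<exists>\<xi>. m * (norm \<xi>)\<^sup>2 < s * (norm (C \<xi>))\<^sup>2 + (norm (D \<xi>))\<^sup>2 / s"
  shows "\<exists>s>0. \<exists>\<xi>. m * (norm \<xi>)\<^sup>2 < s * (norm (C \<xi>))\<^sup>2 + (norm (D \<xi>))\<^sup>2 / s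
    \<and> s * norm (C \<xi>) = norm (D \<xi>)"
proof (rule ccontr)
  assume none: "\<not> ?thesis"
  \<comment> \<open>The inequality multiplied by \<open>s\<close>: without division both sides are
    continuous in \<open>s\<close> on all of the reals, so \<open>U\<close> and \<open>V\<close> are
    open.\<close>
  define L where "L s \<xi> \<longleftrightarrow> m * s * (norm \<xi>)\<^sup>2 < s\<^sup>2 * (norm (C \<xi>))\<^sup>2 + (norm (D \<xi>))\<^sup>2" for s \<xi>
  have L: "L s \<xi> \<longleftrightarrow> m * (norm \<xi>)\<^sup>2 < s * (norm (C \<xi>))\<^sup>2 + (norm (D \<xi>))\<^sup>2 / s"
    if "0 < s" for s \<xi>
    using that by (simp add: L_def field_simps power2_eq_square)
  have nobal: "s\<^sup>2 * (norm (C \<xi>))\<^sup>2 \<noteq> (norm (D \<xi>))\<^sup>2" if "0 < s" "L s \<xi>" for s \<xi>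
  proof
    assume "s\<^sup>2 * (norm (C \<xi>))\<^sup>2 = (norm (D \<xi>))\<^sup>2"
    then have "(s * norm (C \<xi>))\<^sup>2 = (norm (D \<xi>))\<^sup>2" by (simp add: power_mult_distrib)
    then have "s * norm (C \<xi>) = norm (D \<xi>)"
      using \<open>0 < s\<close> by simp
    with none that L[OF \<open>0 < s\<close>] show False by blast
  qed
  define U where "U = {s. \<exists>\<xi>. L s \<xi> \<and> (norm (D \<xi>))\<^sup>2 < s\<^sup>2 * (norm (C \<xi>))\<^sup>2}"
  define V where "V = {s. \<exists>\<xi>. L s \<xi> \<and> s\<^sup>2 * (norm (C \<xi>))\<^sup>2 < (norm (D \<xi>))\<^sup>2}"
  have "open U" "open V"
    unfolding U_def V_def L_def
    by (intro open_Collect_ex open_Collect_conj open_Collect_less continuous_intros)+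
  moreover have cover: "{0<..} \<subseteq> U \<union> V"
  proof
    fix s :: real assume "s \<in> {0<..}"
    then have "0 < s" by simp
    with large L obtain \<xi> where "L s \<xi>" by blast
    with nobal[OF \<open>0 < s\<close> this] show "s \<in> U \<union> V"
      by (auto simp: U_def V_def neq_iff)
  qed
  moreover have "U \<inter> V \<inter> {0<..} = {}"
  proof (rule ccontr)
    assume "U \<inter> V \<inter> {0<..} \<noteq> {}"
    then obtain s \<xi> \<zeta> where "0 < s" and
      "L s \<xi>" "(norm (D \<xi>))\<^sup>2 < s\<^sup>2 * (norm (C \<xi>))\<^sup>2"
      "L s \<zeta>" "s\<^sup>2 * (norm (C \<zeta>))\<^sup>2 < (norm (D \<zeta>))\<^sup>2"
      unfolding U_def V_def by auto
    with balanced_vector_on_segment[OF C D, of "m * s" \<xi> "s\<^sup>2" \<zeta>]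
    obtain \<omega> where "L s \<omega>" "s\<^sup>2 * (norm (C \<omega>))\<^sup>2 = (norm (D \<omega>))\<^sup>2"
      unfolding L_def by auto
    with nobal \<open>0 < s\<close> show False by blast
  qed
  ultimately consider "U \<inter> {0<..} = {}" | "V \<inter> {0<..} = {}"
    using connectedD[of "{0::real<..}" U V] by auto
  then show False
  proof cases
    case 1
    obtain K where K: "0 < K" "\<And>\<xi>. norm (D \<xi>) \<le> norm \<xi> * K"
      using bounded_linear.pos_bounded[OF D] by blast
    \<comment> \<open>Chosen so that \<open>m * s\<close> equals \<open>2 * K\<^sup>2\<close>. If
      the \<open>D\<close> term dominates, \<open>L\<close> bounds
      \<open>m * s * (norm \<xi>)\<^sup>2\<close> strictly by twice that term, which is at most
      \<open>2 * K\<^sup>2 * (norm \<xi>)\<^sup>2\<close>. Case 2 mirrors this with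
      \<open>C\<close>.\<close>
    define s where "s = 2 * K\<^sup>2 / m"
    have "0 < s" using K \<open>0 < m\<close> by (simp add: s_def)
    with 1 cover have "s \<in> V" by auto
    then obtain \<xi> where \<xi>: "L s \<xi>" "s\<^sup>2 * (norm (C \<xi>))\<^sup>2 < (norm (D \<xi>))\<^sup>2"
      by (auto simp: V_def)
    have "(norm (D \<xi>))\<^sup>2 \<le> (norm \<xi> * K)\<^sup>2" using K(2) by (intro power_mono) auto
    moreover have "m * s = 2 * K\<^sup>2" using \<open>0 < m\<close> by (simp add: s_def)
    ultimately have "2 * (norm (D \<xi>))\<^sup>2 \<le> m * s * (norm \<xi>)\<^sup>2"
      by (simp add: power_mult_distrib mult.commute)
    then show False using \<xi> unfolding L_def by linarith
  next
    case 2
    obtain K where K: "0 < K" "\<And>\<xi>. norm (C \<xi>) \<le> norm \<xi> * K"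
      using bounded_linear.pos_bounded[OF C] by blast
    define s where "s = m / (2 * K\<^sup>2)"
    have "0 < s" using K \<open>0 < m\<close> by (simp add: s_def)
    with 2 cover have "s \<in> U" by auto
    then obtain \<xi> where \<xi>: "L s \<xi>" "(norm (D \<xi>))\<^sup>2 < s\<^sup>2 * (norm (C \<xi>))\<^sup>2"
      by (auto simp: U_def)
    have "(norm (C \<xi>))\<^sup>2 \<le> (norm \<xi> * K)\<^sup>2" using K(2) by (intro power_mono) auto
    then have "2 * s\<^sup>2 * (norm (C \<xi>))\<^sup>2 \<le> 2 * s\<^sup>2 * (norm \<xi> * K)\<^sup>2"
      by (intro mult_left_mono) auto
    moreover have "2 * s\<^sup>2 * (norm \<xi> * K)\<^sup>2 = m * s * (norm \<xi>)\<^sup>2"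
      using K(1) by (simp add: s_def power2_eq_square field_simps)
    ultimately show False using \<xi> unfolding L_def by linarith
  qed
qed

section \<open>Adjoints, matrix norms and the row with entries \<open>a\<close> and
  \<open>b\<close>\<close>

lemma scaleR_mat_vec: "(c *\<^sub>R A) *v x = c *\<^sub>R (A *v x)"
  for A :: "'a::real_normed_field^'n^'m"
  by (simp add: matrix_vector_mult_def vec_eq_iff scaleR_sum_right)

lemma mat_vec_scaleR: "A *v (c *\<^sub>R x) = c *\<^sub>R (A *v x)"
  for A :: "'a::real_normed_field^'n^'m"
  by (simp add: matrix_vector_mult_def vec_eq_iff scaleR_sum_right)

text \<open>The inner product here is the real part of the Hermitian one, and the conjugate
  transpose is the adjoint for both.\<close>

lemma inner_conj_transpose:
  fixes A :: "complex^'n^'m"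
  shows "(A *v x) \<bullet> y = x \<bullet> (conj_transpose A *v y)"
proof -
  have "(A *v x) \<bullet> y = (\<Sum>i\<in>UNIV. \<Sum>j\<in>UNIV. (A $ i $ j * x $ j) \<bullet> y $ i)"
    by (simp add: inner_vec_def matrix_vector_mult_def inner_sum_left)
  also have "\<dots> = (\<Sum>j\<in>UNIV. \<Sum>i\<in>UNIV. (A $ i $ j * x $ j) \<bullet> y $ i)"
    by (rule sum.swap)
  also have "\<dots> = (\<Sum>j\<in>UNIV. \<Sum>i\<in>UNIV. x $ j \<bullet> (cnj (A $ i $ j) * y $ i))"
    by (intro sum.cong refl) (simp add: inner_complex_def algebra_simps)
  also have "\<dots> = x \<bullet> (conj_transpose A *v y)"
    by (simp add: inner_vec_def matrix_vector_mult_def inner_sum_right conj_transpose_def)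
  finally show ?thesis .
qed

lemma mat_opnorm_bound: "norm (A *v v) \<le> mat_opnorm A * norm v"
  unfolding mat_opnorm_def by (rule onorm) (rule matrix_vector_mul_bounded_linear)

lemma mat_opnorm_pos_le: "0 \<le> mat_opnorm A"
  unfolding mat_opnorm_def by (rule onorm_pos_le) (rule matrix_vector_mul_bounded_linear)

lemma mat_opnorm_le:
  assumes "\<And>v. norm (A *v v) \<le> c * norm v"
  shows "mat_opnorm A \<le> c"
  unfolding mat_opnorm_def using assms by (rule onorm_le)

text \<open>The matrix is positive semidefinite with quadratic form \<open>?Q\<close>, and the norm
  of such a matrix is the least bound of its form on unit vectors.\<close>

lemma mat_opnorm_row_le_iff:
  fixes a b :: "complex^'n^'n"
  assumes "0 < s" "0 \<le> c"
  shows "mat_opnorm (s *\<^sub>R (a ** conj_transpose a) + (1 / s) *\<^sub>R (b ** conj_transpose b)) \<le> c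
    \<longleftrightarrow> (\<forall>\<xi>. s * (norm (conj_transpose a *v \<xi>))\<^sup>2 + (norm (conj_transpose b *v \<xi>))\<^sup>2 / s
            \<le> c * (norm \<xi>)\<^sup>2)"
    (is "mat_opnorm ?M \<le> c \<longleftrightarrow> (\<forall>\<xi>. ?Q \<xi> \<le> _)")
proof -
  have M: "(?M *v \<xi>) \<bullet> \<zeta> = s * ((conj_transpose a *v \<xi>) \<bullet> (conj_transpose a *v \<zeta>))
      + (conj_transpose b *v \<xi>) \<bullet> (conj_transpose b *v \<zeta>) / s" for \<xi> \<zeta>
  proof -
    have "((A ** conj_transpose A) *v \<xi>) \<bullet> \<zeta>
        = (conj_transpose A *v \<xi>) \<bullet> (conj_transpose A *v \<zeta>)" for A :: "complex^'n^'n"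
      unfolding matrix_vector_mul_assoc[symmetric] by (rule inner_conj_transpose)
    then show ?thesis
      by (simp add: matrix_vector_mult_add_rdistrib scaleR_mat_vec inner_add_left)
  qed
  show ?thesis
  proof (intro iffI allI)
    fix \<xi> assume "mat_opnorm ?M \<le> c"
    have "?Q \<xi> = (?M *v \<xi>) \<bullet> \<xi>" by (simp add: M power2_norm_eq_inner)
    also have "\<dots> \<le> norm (?M *v \<xi>) * norm \<xi>" by (rule norm_cauchy_schwarz)
    also have "\<dots> \<le> (mat_opnorm ?M * norm \<xi>) * norm \<xi>"
      by (intro mult_right_mono mat_opnorm_bound) simp
    also have "\<dots> \<le> (c * norm \<xi>) * norm \<xi>"
      by (intro mult_right_mono \<open>mat_opnorm ?M \<le> c\<close>) simp_all
    finally show "?Q \<xi> \<le> c * (norm \<xi>)\<^sup>2" by (simp add: power2_eq_square mult.assoc)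
  next
    assume Q: "\<forall>\<xi>. ?Q \<xi> \<le> c * (norm \<xi>)\<^sup>2"
    show "mat_opnorm ?M \<le> c"
    proof (rule mat_opnorm_le)
      fix \<xi>
      define \<zeta> where "\<zeta> = ?M *v \<xi>"
      show "norm (?M *v \<xi>) \<le> c * norm \<xi>"
      proof (cases "\<xi> = 0 \<or> \<zeta> = 0")
        case True
        then show ?thesis using \<open>0 \<le> c\<close> by (auto simp: \<zeta>_def)
      next
        case False
        then have "0 < norm \<xi>" "0 < norm \<zeta>" by auto
        \<comment> \<open>Cauchy--Schwarz for the positive semidefinite form of the matrix, from
          nonnegativity of the form at this vector\<close>
        define \<omega> where "\<omega> = norm \<zeta> *\<^sub>R \<xi> - norm \<xi> *\<^sub>R \<zeta>"
        have sq: "(norm (norm \<zeta> *\<^sub>R x - norm \<xi> *\<^sub>R y))\<^sup>2 = (norm \<zeta>)\<^sup>2 * (norm x)\<^sup>2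
            + (norm \<xi>)\<^sup>2 * (norm y)\<^sup>2 - 2 * norm \<xi> * norm \<zeta> * (x \<bullet> y)" for x y :: "complex^'n"
          using norm_scaled_combination_sq[of "norm \<zeta>" x "- norm \<xi>" y] by simp
        have "0 \<le> ?Q \<omega>" using \<open>0 < s\<close> by simp
        also have "?Q \<omega> = (norm \<zeta>)\<^sup>2 * ?Q \<xi> + (norm \<xi>)\<^sup>2 * ?Q \<zeta>
            - 2 * norm \<xi> * norm \<zeta> * ((?M *v \<xi>) \<bullet> \<zeta>)"
          unfolding M using \<open>0 < s\<close>
          by (simp add: \<omega>_def matrix_vector_mult_diff_distrib mat_vec_scaleR sq field_simps)
        also have "(?M *v \<xi>) \<bullet> \<zeta> = (norm \<zeta>)\<^sup>2"
          by (simp add: \<zeta>_def power2_norm_eq_inner)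
        finally have "2 * norm \<xi> * norm \<zeta> * (norm \<zeta>)\<^sup>2 \<le> (norm \<zeta>)\<^sup>2 * ?Q \<xi> + (norm \<xi>)\<^sup>2 * ?Q \<zeta>"
          by simp
        also have "\<dots> \<le> (norm \<zeta>)\<^sup>2 * (c * (norm \<xi>)\<^sup>2) + (norm \<xi>)\<^sup>2 * (c * (norm \<zeta>)\<^sup>2)"
          using Q by (intro add_mono mult_left_mono) auto
        also have "\<dots> = 2 * norm \<xi> * (norm \<zeta>)\<^sup>2 * (c * norm \<xi>)"
          by (simp add: power2_eq_square)
        finally have "(2 * norm \<xi> * (norm \<zeta>)\<^sup>2) * norm \<zeta> \<le> (2 * norm \<xi> * (norm \<zeta>)\<^sup>2) * (c * norm \<xi>)"
          by (simp only: ac_simps)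
        then show ?thesis
          using \<open>0 < norm \<xi>\<close> \<open>0 < norm \<zeta>\<close> unfolding \<zeta>_def[symmetric]
          by (subst (asm) mult_le_cancel_left_pos) auto
      qed
    qed
  qed
qed

text \<open>A row and its adjoint column have the same norm. \<open>Q\<close> bounds the column of
  the scaled \<open>a*\<close> and \<open>b*\<close> by the square root of \<open>c\<close>; the
  conclusion is that bound for the row, applied to \<open>y\<close> divided by the root of
  \<open>s\<close> and \<open>z\<close> multiplied by it.\<close>

lemma norm_row_apply_le:
  fixes a b :: "complex^'n^'n"
  assumes "0 < s" "0 < c"
    and Q: "\<And>\<xi>. s * (norm (conj_transpose a *v \<xi>))\<^sup>2 + (norm (conj_transpose b *v \<xi>))\<^sup>2 / s
            \<le> c * (norm \<xi>)\<^sup>2"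
  shows "(norm (a *v y + b *v z))\<^sup>2 \<le> c * ((norm y)\<^sup>2 / s + s * (norm z)\<^sup>2)"
proof -
  have amgm: "2 * (x \<bullet> w) \<le> d * (norm x)\<^sup>2 + (norm w)\<^sup>2 / d" if "0 < d" for x w :: "complex^'n" and d
  proof -
    have "0 \<le> (norm (d *\<^sub>R x - w))\<^sup>2 / d" using that by simp
    also have "\<dots> = d * (norm x)\<^sup>2 + (norm w)\<^sup>2 / d - 2 * (x \<bullet> w)"
      using that norm_scaled_combination_sq[of d x "- 1" w] by (simp add: field_simps power2_eq_square)
    finally show ?thesis by simp
  qed
  define w where "w = a *v y + b *v z"
  have "2 * (norm w)\<^sup>2 = 2 * (y \<bullet> (conj_transpose a *v w)) + 2 * (z \<bullet> (conj_transpose b *v w))"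
    unfolding power2_norm_eq_inner
    by (subst (1) w_def) (simp add: inner_add_left inner_conj_transpose)
  \<comment> \<open>The weights \<open>c / s\<close> and \<open>c * s\<close> make the adjoint terms
    add up to the left side of \<open>Q\<close> at \<open>w\<close>, divided by \<open>c\<close>.
    This is at most the square of \<open>norm w\<close> and is absorbed on the left.\<close>
  also have "\<dots> \<le> (c / s * (norm y)\<^sup>2 + (norm (conj_transpose a *v w))\<^sup>2 / (c / s))
      + (c * s * (norm z)\<^sup>2 + (norm (conj_transpose b *v w))\<^sup>2 / (c * s))"
    using assms by (intro add_mono amgm) auto
  also have "\<dots> = c * ((norm y)\<^sup>2 / s + s * (norm z)\<^sup>2)
      + (s * (norm (conj_transpose a *v w))\<^sup>2 + (norm (conj_transpose b *v w))\<^sup>2 / s) / c"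
    using assms by (simp add: field_simps)
  also have "\<dots> \<le> c * ((norm y)\<^sup>2 / s + s * (norm z)\<^sup>2) + (c * (norm w)\<^sup>2) / c"
    using assms by (intro add_left_mono divide_right_mono Q) auto
  finally show ?thesis using \<open>0 < c\<close> by (simp add: w_def)
qed

section \<open>Entrywise conjugation of vectors\<close>

definition cnj_vec :: "complex^'n \<Rightarrow> complex^'n" where
  "cnj_vec v = (\<chi> i. cnj (v $ i))"

lemma norm_cnj_vec [simp]: "norm (cnj_vec v) = norm v"
  by (simp add: norm_vec_def cnj_vec_def)

lemma cnj_vec_cnj_vec [simp]: "cnj_vec (cnj_vec v) = v"
  by (simp add: cnj_vec_def vec_eq_iff)

lemma cnj_vec_scaleR: "cnj_vec (c *\<^sub>R v) = c *\<^sub>R cnj_vec v"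
  by (simp add: cnj_vec_def vec_eq_iff)

text \<open>For a symmetric matrix the adjoint is the entrywise conjugate. Symmetry of
  \<open>a\<close> and \<open>b\<close> enters the whole argument through this identity.\<close>

lemma conj_transpose_cnj_vec:
  assumes "transpose A = A"
  shows "conj_transpose A *v cnj_vec v = cnj_vec (A *v v)"
proof -
  have "A $ j $ i = A $ i $ j" for i j
    using arg_cong[OF assms, of "\<lambda>M. M $ i $ j"] by (simp add: transpose_def)
  then show ?thesis
    by (simp add: conj_transpose_def cnj_vec_def matrix_vector_mult_def vec_eq_iff)
qed

section \<open>Block operator norms and the upper bound for the amplifications\<close>

lemma block_vec_norm_nonneg: "0 \<le> block_vec_norm n v"
  by (simp add: block_vec_norm_def sum_nonneg)

lemma block_vec_norm_sq: "(block_vec_norm n v)\<^sup>2 = (\<Sum>i<n. (norm (v i))\<^sup>2)"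
  by (simp add: block_vec_norm_def sum_nonneg)

lemma block_vec_norm_scaleR: "block_vec_norm n (\<lambda>i. c *\<^sub>R v i) = \<bar>c\<bar> * block_vec_norm n v"
  by (simp add: block_vec_norm_def power_mult_distrib sum_distrib_left[symmetric] real_sqrt_mult)

lemma block_apply_scaleR: "block_apply n X (\<lambda>i. c *\<^sub>R v i) = (\<lambda>i. c *\<^sub>R block_apply n X v i)"
  by (simp add: block_apply_def mat_vec_scaleR scaleR_sum_right)

lemma block_opnorm_bound:
  fixes X :: "nat \<Rightarrow> nat \<Rightarrow> complex^'k^'k"
  shows "block_vec_norm n (block_apply n X v) \<le> block_opnorm n X * block_vec_norm n v"
\<comment> \<open>On functions \<open>block_vec_norm n\<close> is only a seminorm. Its vanishing
  gives \<open>v i = 0\<close> just for indices below \<open>n\<close>, which are all that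
  \<open>block_apply\<close> reads.\<close>
proof (cases "block_vec_norm n v = 0")
  case True
  then have "\<forall>i<n. v i = 0"
    by (simp add: block_vec_norm_def sum_nonneg_eq_0_iff)
  then have "block_apply n X v = (\<lambda>i. 0)"
    by (simp add: block_apply_def)
  then show ?thesis using True by (simp add: block_vec_norm_def)
next
  case False
  define c where "c = block_vec_norm n v"
  have "0 < c" using False block_vec_norm_nonneg[of n v] by (simp add: c_def)
  have "block_vec_norm n (block_apply n X (\<lambda>i. (1 / c) *\<^sub>R v i)) \<le> block_opnorm n X"
    unfolding block_opnorm_def using \<open>0 < c\<close>
    by (intro cSUP_upper bdd_above_block_opnorm)
      (simp add: block_vec_norm_scaleR, simp add: c_def)
  then show ?thesis
    using \<open>0 < c\<close> unfolding block_apply_scaleR block_vec_norm_scaleR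
    by (simp add: field_simps flip: c_def)
qed

lemma block_opnorm_le:
  assumes "\<And>v. block_vec_norm n v \<le> 1 \<Longrightarrow> block_vec_norm n (block_apply n X v) \<le> c"
  shows "block_opnorm n X \<le> c"
proof -
  have "block_vec_norm n (\<lambda>_. 0) \<le> 1" by (simp add: block_vec_norm_def)
  then have "{v. block_vec_norm n v \<le> 1} \<noteq> {}" by blast
  then show ?thesis unfolding block_opnorm_def using assms by (intro cSUP_least) auto
qed

lemma block_opnorm_1: "block_opnorm 1 X = mat_opnorm (X 0 0)"
proof (rule antisym)
  show "block_opnorm 1 X \<le> mat_opnorm (X 0 0)"
  proof (rule block_opnorm_le)
    fix v :: "nat \<Rightarrow> complex^'a" assume "block_vec_norm 1 v \<le> 1"
    then have "norm (v 0) \<le> 1" by (simp add: block_vec_norm_def)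
    with mat_opnorm_pos_le[of "X 0 0"] have "mat_opnorm (X 0 0) * norm (v 0) \<le> mat_opnorm (X 0 0)"
      by (simp add: mult_left_le)
    with mat_opnorm_bound[of "X 0 0" "v 0"]
    show "block_vec_norm 1 (block_apply 1 X v) \<le> mat_opnorm (X 0 0)"
      by (simp add: block_vec_norm_def block_apply_def)
  qed
  show "mat_opnorm (X 0 0) \<le> block_opnorm 1 X"
    by (rule mat_opnorm_le)
      (use block_opnorm_bound[of 1 X "\<lambda>_. v" for v] in \<open>simp add: block_vec_norm_def block_apply_def\<close>)
qed

lemma map_norm_le_cb_norm: "map_norm T \<le> cb_norm T"
proof -
  have "map_norm T \<le> ampliation_norm 1 T"
    unfolding map_norm_def
  proof (rule SUP_least)
    fix x :: "complex^'a^'a" assume "x \<in> {x. mat_opnorm x \<le> 1}"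
    then have "(\<lambda>_ _. x) \<in> {X. block_opnorm 1 X \<le> 1}"
      using block_opnorm_1[of "\<lambda>_ _. x"] by simp
    then have "ereal (block_opnorm 1 (ampliation T (\<lambda>_ _. x))) \<le> ampliation_norm 1 T"
      unfolding ampliation_norm_def by (rule SUP_upper)
    then show "ereal (mat_opnorm (T x)) \<le> ampliation_norm 1 T"
      unfolding block_opnorm_1 by (simp add: ampliation_def)
  qed
  also have "\<dots> \<le> cb_norm T"
    unfolding cb_norm_def by (rule SUP_upper) simp
  finally show ?thesis .
qed

text \<open>The amplified map is a row times a diagonal copy of \<open>X\<close> times a column. Row
  and column each contribute the root of \<open>c\<close> to the norm, hence a factor
  \<open>c\<close> each to the squared estimate, while \<open>X\<close> is contractive.\<close>

lemma block_opnorm_ampliation_elem_op_le: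
  fixes a b :: "complex^'n^'n"
  assumes a: "transpose a = a" and b: "transpose b = b"
    and s: "0 < s" and c: "0 < c"
    and Q: "\<And>\<xi>. s * (norm (conj_transpose a *v \<xi>))\<^sup>2 + (norm (conj_transpose b *v \<xi>))\<^sup>2 / s
            \<le> c * (norm \<xi>)\<^sup>2"
    and X: "block_opnorm n X \<le> 1"
  shows "block_opnorm n (ampliation (elem_op a b) X) \<le> c"
proof (rule block_opnorm_le)
  fix v :: "nat \<Rightarrow> complex^'n" assume v: "block_vec_norm n v \<le> 1"
  have contr: "(\<Sum>i<n. (norm (block_apply n X w i))\<^sup>2) \<le> (\<Sum>i<n. (norm (w i))\<^sup>2)" for w
  proof -
    have "block_opnorm n X * block_vec_norm n w \<le> block_vec_norm n w"
      using mult_right_mono[OF X block_vec_norm_nonneg] by simp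
    then have "block_vec_norm n (block_apply n X w) \<le> block_vec_norm n w"
      using block_opnorm_bound[of n X w] by linarith
    then show ?thesis by (simp add: block_vec_norm_def)
  qed
  define y where "y = block_apply n X (\<lambda>j. b *v v j)"
  define z where "z = block_apply n X (\<lambda>j. a *v v j)"
  have "block_apply n (ampliation (elem_op a b) X) v i = a *v y i + b *v z i" for i
    by (simp add: block_apply_def ampliation_def elem_op_def y_def z_def matrix_vector_mul_assoc
        matrix_vector_mult_add_rdistrib sum.distrib matrix_mul_assoc mult.assoc
        linear_sum[OF matrix_vector_mul_linear])
  then have "(block_vec_norm n (block_apply n (ampliation (elem_op a b) X) v))\<^sup>2
      = (\<Sum>i<n. (norm (a *v y i + b *v z i))\<^sup>2)"
    by (simp add: block_vec_norm_sq)
  also have "\<dots> \<le> (\<Sum>i<n. c * ((norm (y i))\<^sup>2 / s + s * (norm (z i))\<^sup>2))"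
    by (intro sum_mono norm_row_apply_le s c Q)
  also have "\<dots> = c * ((\<Sum>i<n. (norm (y i))\<^sup>2) / s + s * (\<Sum>i<n. (norm (z i))\<^sup>2))"
    by (simp add: sum_distrib_left sum_divide_distrib sum.distrib distrib_left)
  also have "\<dots> \<le> c * ((\<Sum>i<n. (norm (b *v v i))\<^sup>2) / s + s * (\<Sum>i<n. (norm (a *v v i))\<^sup>2))"
    using s c unfolding y_def z_def
    by (intro mult_left_mono add_mono divide_right_mono contr) auto
  also have "\<dots> = c * (\<Sum>i<n. s * (norm (a *v v i))\<^sup>2 + (norm (b *v v i))\<^sup>2 / s)"
    by (simp add: sum_distrib_left sum_divide_distrib sum.distrib distrib_left)
  also have "\<dots> \<le> c * (\<Sum>i<n. c * (norm (v i))\<^sup>2)"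
  proof (intro mult_left_mono sum_mono)
    fix i
    show "s * (norm (a *v v i))\<^sup>2 + (norm (b *v v i))\<^sup>2 / s \<le> c * (norm (v i))\<^sup>2"
      \<comment> \<open>At the conjugate vector the adjoints turn into \<open>a\<close> and
        \<open>b\<close> themselves, so \<open>Q\<close> bounds the column as well.\<close>
      using Q[of "cnj_vec (v i)"] by (simp add: conj_transpose_cnj_vec a b)
  qed (use c in simp)
  also have "\<dots> = c\<^sup>2 * (block_vec_norm n v)\<^sup>2"
    unfolding block_vec_norm_sq sum_distrib_left[symmetric] by (simp add: power2_eq_square)
  also have "\<dots> \<le> c\<^sup>2"
    using v block_vec_norm_nonneg[of n v] by (simp add: mult_left_le power_le_one)
  finally show "block_vec_norm n (block_apply n (ampliation (elem_op a b) X) v) \<le> c"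
    by (rule power2_le_imp_le) (use c in simp)
qed

section \<open>Contractions in dimension two and the lower bound\<close>

lemma norm_complex_combination_sq:
  fixes u v :: "complex^'n"
  shows "(norm (\<alpha> *s u + \<beta> *s v))\<^sup>2 = (cmod \<alpha>)\<^sup>2 * (norm u)\<^sup>2 + (cmod \<beta>)\<^sup>2 * (norm v)\<^sup>2
    + 2 * Re (\<alpha> * cnj \<beta> * (\<Sum>i\<in>UNIV. u $ i * cnj (v $ i)))"
proof -
  have sq: "(norm w)\<^sup>2 = (\<Sum>i\<in>UNIV. (cmod (w $ i))\<^sup>2)" for w :: "complex^'n"
    by (simp add: norm_vec_def L2_set_def sum_nonneg)
  have "(cmod (\<alpha> * x + \<beta> * y))\<^sup>2 = (cmod \<alpha>)\<^sup>2 * (cmod x)\<^sup>2 + (cmod \<beta>)\<^sup>2 * (cmod y)\<^sup>2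
      + 2 * Re (\<alpha> * cnj \<beta> * (x * cnj y))" for x y
    unfolding cmod_power2 by (simp add: algebra_simps power2_eq_square)
  then show ?thesis
    by (simp add: sq sum.distrib sum_distrib_left)
qed

text \<open>Equal norms make the Gram matrix of \<open>u\<close>, \<open>v\<close> agree with that
  of \<open>cnj_vec v\<close>, \<open>cnj_vec u\<close>, so the required assignment is isometric on
  the span of \<open>u\<close> and \<open>v\<close>. If they are independent, the span is the whole
  plane; otherwise a rank-one matrix suffices.\<close>

lemma exists_contraction_swap_cnj:
  fixes u v :: "complex^2"
  assumes "norm u = norm v"
  shows "\<exists>x :: complex^2^2. mat_opnorm x \<le> 1 \<and> x *v u = cnj_vec v \<and> x *v v = cnj_vec u"
proof -
  have swap: "norm (\<alpha> *s cnj_vec v + \<beta> *s cnj_vec u) = norm (\<alpha> *s u + \<beta> *s v)" for \<alpha> \<beta>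
  proof -
    have "(norm (\<alpha> *s cnj_vec v + \<beta> *s cnj_vec u))\<^sup>2 = (norm (\<alpha> *s u + \<beta> *s v))\<^sup>2"
      unfolding norm_complex_combination_sq norm_cnj_vec assms
      by (simp add: cnj_vec_def mult.commute)
    then show ?thesis by simp
  qed
  define d where "d = u $ 1 * v $ 2 - u $ 2 * v $ 1"
  show ?thesis
  proof (cases "d = 0")
    case False
    \<comment> \<open>The matrix with columns \<open>cnj_vec v\<close>, \<open>cnj_vec u\<close>
      times the inverse of the matrix with columns \<open>u\<close>, \<open>v\<close>, whose
      determinant is \<open>d\<close>. Below, \<open>\<alpha>\<close> and \<open>\<beta>\<close> are
      the coordinates of \<open>w\<close> by Cramer's rule.\<close>
    define x :: "complex^2^2" where "x = (\<chi> i. vector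
      [(cnj (v $ i) * v $ 2 - cnj (u $ i) * u $ 2) / d, (cnj (u $ i) * u $ 1 - cnj (v $ i) * v $ 1) / d])"
    have xu: "x *v u = cnj_vec v" and xv: "x *v v = cnj_vec u"
      using False
      by (simp_all add: x_def vec_eq_iff matrix_vector_mult_def sum_2 cnj_vec_def field_simps)
        (simp_all add: d_def algebra_simps)
    have "mat_opnorm x \<le> 1"
    proof (rule mat_opnorm_le)
      fix w :: "complex^2"
      define \<alpha> where "\<alpha> = (w $ 1 * v $ 2 - w $ 2 * v $ 1) / d"
      define \<beta> where "\<beta> = (u $ 1 * w $ 2 - u $ 2 * w $ 1) / d"
      have w: "w = \<alpha> *s u + \<beta> *s v"
        using False
        by (simp add: vec_eq_iff forall_2 \<alpha>_def \<beta>_def field_simps) (simp add: d_def algebra_simps)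
      then have "x *v w = \<alpha> *s cnj_vec v + \<beta> *s cnj_vec u"
        by (simp add: matrix_vector_right_distrib vector_scalar_commute xu xv)
      then show "norm (x *v w) \<le> 1 * norm w"
        using swap w by simp
    qed
    with xu xv show ?thesis by blast
  next
    case d: True
    show ?thesis
    proof (cases "u = 0")
      case True
      with assms have "v = 0" by simp
      moreover have "mat_opnorm (0 :: complex^2^2) \<le> 1" by (rule mat_opnorm_le) simp
      moreover have "cnj_vec (0 :: complex^2) = 0" by (simp add: cnj_vec_def vec_eq_iff)
      ultimately show ?thesis using True by (intro exI[of _ 0]) simp
    next
      case False
      then obtain i where i: "u $ i \<noteq> 0" by (auto simp: vec_eq_iff)
      define k where "k = v $ i / u $ i"
      have "u $ i * v $ j = u $ j * v $ i" for j
        using d exhaust_2[of i] exhaust_2[of j] by (auto simp: d_def mult.commute)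
      then have v: "v = k *s u"
        using i by (simp add: vec_eq_iff k_def field_simps)
      have "norm v = cmod k * norm u"
        unfolding v by (simp add: norm_vec_def norm_mult L2_set_right_distrib)
      with assms False have "cmod k = 1" by (metis mult_cancel_right1 norm_eq_zero)
      have nu: "(\<Sum>j\<in>UNIV. cnj (u $ j) * u $ j) = of_real ((norm u)\<^sup>2)"
      proof -
        have "(norm u)\<^sup>2 = (\<Sum>j\<in>UNIV. (cmod (u $ j))\<^sup>2)"
          by (simp add: norm_vec_def L2_set_def sum_nonneg)
        moreover have "complex_of_real ((cmod z)\<^sup>2) = cnj z * z" for z
          by (simp add: complex_norm_square mult.commute del: of_real_power)
        ultimately show ?thesis by (simp del: of_real_power)
      qed
      \<comment> \<open>With \<open>v = k *s u\<close> and \<open>k\<close> of modulus one,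
        \<open>x\<close> projects orthogonally onto the line of \<open>u\<close> and then sends
        \<open>u\<close> to \<open>cnj k *s cnj_vec u\<close>, which is
        \<open>cnj_vec v\<close>.\<close>
      define c where "c = cnj k / of_real ((norm u)\<^sup>2)"
      define x :: "complex^2^2" where "x = (\<chi> i j. c * cnj (u $ i) * cnj (u $ j))"
      have x: "x *v w = (c * (\<Sum>j\<in>UNIV. cnj (u $ j) * w $ j)) *s cnj_vec u" for w
        by (simp add: x_def matrix_vector_mult_def vec_eq_iff cnj_vec_def sum_distrib_left algebra_simps)
      have xu: "x *v u = cnj k *s cnj_vec u"
        using False by (simp add: x nu c_def)
      then have "x *v u = cnj_vec v"
        by (simp add: v cnj_vec_def vec_eq_iff)
      moreover have "x *v v = cnj_vec u"
      proof -
        have "k * cnj k = 1" using \<open>cmod k = 1\<close> complex_norm_square[of k] by simp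
        then show ?thesis by (simp add: v vector_scalar_commute xu)
      qed
      moreover have "mat_opnorm x \<le> 1"
      proof (rule mat_opnorm_le)
        fix w :: "complex^2"
        have "cmod (\<Sum>j\<in>UNIV. cnj (u $ j) * w $ j) \<le> (\<Sum>j\<in>UNIV. \<bar>cmod (u $ j)\<bar> * \<bar>cmod (w $ j)\<bar>)"
          by (rule order_trans[OF norm_sum]) (simp add: norm_mult)
        also have "\<dots> \<le> norm u * norm w"
          unfolding norm_vec_def by (rule L2_set_mult_ineq)
        finally have "cmod c * cmod (\<Sum>j\<in>UNIV. cnj (u $ j) * w $ j) * norm u
            \<le> cmod c * (norm u * norm w) * norm u"
          by (intro mult_right_mono mult_left_mono) auto
        moreover have "norm (x *v w) = cmod c * cmod (\<Sum>j\<in>UNIV. cnj (u $ j) * w $ j) * norm u"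
          unfolding x by (simp add: norm_vec_def norm_mult L2_set_right_distrib cnj_vec_def)
        moreover have "cmod c * (norm u * norm w) * norm u = norm w"
          using False \<open>cmod k = 1\<close> by (simp add: c_def norm_divide norm_mult power2_eq_square)
        ultimately show "norm (x *v w) \<le> 1 * norm w" by simp
      qed
      ultimately show ?thesis by blast
    qed
  qed
qed

text \<open>The contraction aligns \<open>x *v v\<close> with \<open>a* \<xi>\<close> and
  \<open>x *v u\<close> with \<open>b* \<xi>\<close>. Pairing the image of \<open>\<eta>\<close>
  with \<open>\<xi>\<close> therefore gives the full right side of \<open>m\<close>, while
  \<open>\<eta>\<close> and \<open>\<xi>\<close> have equal norm.\<close>

lemma elem_op_attains:
  fixes a b :: "complex^2^2"
  assumes a: "transpose a = a" and b: "transpose b = b" and "0 < s"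
    and bal: "s * norm (conj_transpose a *v \<xi>) = norm (conj_transpose b *v \<xi>)"
    and m: "m * (norm \<xi>)\<^sup>2
      < s * (norm (conj_transpose a *v \<xi>))\<^sup>2 + (norm (conj_transpose b *v \<xi>))\<^sup>2 / s"
  shows "\<exists>x. mat_opnorm x \<le> 1 \<and> m \<le> mat_opnorm (elem_op a b x)"
proof -
  define \<eta> where "\<eta> = cnj_vec \<xi>"
  define u where "u = a *v \<eta>"
  define v where "v = b *v \<eta>"
  have a\<xi>: "conj_transpose a *v \<xi> = cnj_vec u" and b\<xi>: "conj_transpose b *v \<xi> = cnj_vec v"
    using conj_transpose_cnj_vec[OF a, of \<eta>] conj_transpose_cnj_vec[OF b, of \<eta>]
    by (simp_all add: \<eta>_def u_def v_def)
  \<comment> \<open>Balance is exactly the equality of norms that the swapping contraction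
    requires.\<close>
  have "norm (s *\<^sub>R u) = norm v" using bal \<open>0 < s\<close> by (simp add: a\<xi> b\<xi>)
  then obtain x where x: "mat_opnorm x \<le> 1" "x *v (s *\<^sub>R u) = cnj_vec v" "x *v v = cnj_vec (s *\<^sub>R u)"
    using exists_contraction_swap_cnj by blast
  have xu: "x *v u = (1 / s) *\<^sub>R cnj_vec v"
    using \<open>0 < s\<close> by (simp add: x(2)[symmetric] mat_vec_scaleR)
  have "elem_op a b x *v \<eta> = a *v (x *v v) + b *v (x *v u)"
    by (simp add: elem_op_def u_def v_def matrix_vector_mul_assoc matrix_vector_mult_add_rdistrib
        matrix_mul_assoc)
  then have "(elem_op a b x *v \<eta>) \<bullet> \<xi> = (x *v v) \<bullet> cnj_vec u + (x *v u) \<bullet> cnj_vec v"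
    by (simp add: inner_add_left inner_conj_transpose a\<xi> b\<xi>)
  also have "\<dots> = s * (norm u)\<^sup>2 + (norm v)\<^sup>2 / s"
    by (simp add: x(3) xu cnj_vec_scaleR power2_norm_eq_inner[symmetric])
  finally have "m * (norm \<xi>)\<^sup>2 < (elem_op a b x *v \<eta>) \<bullet> \<xi>"
    using m by (simp add: a\<xi> b\<xi>)
  also have "\<dots> \<le> norm (elem_op a b x *v \<eta>) * norm \<xi>" by (rule norm_cauchy_schwarz)
  also have "\<dots> \<le> (mat_opnorm (elem_op a b x) * norm \<eta>) * norm \<xi>"
    by (intro mult_right_mono mat_opnorm_bound) simp
  also have "\<dots> = mat_opnorm (elem_op a b x) * (norm \<xi>)\<^sup>2"
    by (simp add: \<eta>_def power2_eq_square)
  finally have "m < mat_opnorm (elem_op a b x)"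
    by (rule mult_right_less_imp_less) simp
  with x(1) show ?thesis by (intro exI[of _ x]) simp
qed

section \<open>Comparison of both norms with the infimum\<close>

theorem proposition4:
  fixes a b :: "complex^2^2"
  assumes "transpose a = a" and "transpose b = b"
  shows "cb_norm (elem_op a b) = map_norm (elem_op a b) \<and>
    map_norm (elem_op a b) =
      ereal (INF x\<in>{0<..}. mat_opnorm (x *\<^sub>R (a ** conj_transpose a)
                                      + (1 / x) *\<^sub>R (b ** conj_transpose b)))"
proof -
  define N where "N x = mat_opnorm (x *\<^sub>R (a ** conj_transpose a)
      + (1 / x) *\<^sub>R (b ** conj_transpose b))" for x
  define I where "I = (INF x\<in>{0<..}. N x)"
  have N_nonneg: "0 \<le> N x" for x by (simp add: N_def mat_opnorm_pos_le)
  have bdd: "bdd_below (N ` {0<..})" using N_nonneg by (intro bdd_belowI2[of _ 0])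
  have "0 \<le> I" unfolding I_def by (rule cINF_greatest) (auto simp: N_nonneg)
  have upper: "cb_norm (elem_op a b) \<le> ereal I"
  proof (rule dense_ge)
    fix e assume "ereal I < e"
    \<comment> \<open>A real number strictly above the infimum is positive even when the infimum is
      zero, and it exceeds \<open>N s\<close> for some \<open>s\<close> whether or not the infimum
      is attained.\<close>
    then obtain c where c: "I < c" "ereal c < e"
      using ereal_dense2 by (metis less_ereal.simps(1))
    then obtain s where s: "0 < s" "N s < c"
      unfolding I_def using cINF_less_iff[OF _ bdd] by auto
    have "0 < c" using \<open>0 \<le> I\<close> c(1) by simp
    have "block_opnorm n (ampliation (elem_op a b) X) \<le> c" if "block_opnorm n X \<le> 1" for n X
    proof (rule block_opnorm_ampliation_elem_op_le[OF assms s(1) \<open>0 < c\<close> _ that])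
      show "s * (norm (conj_transpose a *v \<xi>))\<^sup>2 + (norm (conj_transpose b *v \<xi>))\<^sup>2 / s
          \<le> c * (norm \<xi>)\<^sup>2" for \<xi>
        using mat_opnorm_row_le_iff[OF s(1), of c a b] \<open>0 < c\<close> s(2) by (simp add: N_def)
    qed
    then have "cb_norm (elem_op a b) \<le> ereal c"
      unfolding cb_norm_def ampliation_norm_def by (intro SUP_least) auto
    with c(2) show "cb_norm (elem_op a b) \<le> e" by simp
  qed
  have lower: "ereal I \<le> map_norm (elem_op a b)"
  proof (rule ccontr)
    assume "\<not> ereal I \<le> map_norm (elem_op a b)"
    then obtain m where m: "map_norm (elem_op a b) < ereal m" "m < I"
      using ereal_dense2 by (metis less_ereal.simps(1) not_le)
    have map_norm_ge: "ereal (mat_opnorm (elem_op a b x)) \<le> map_norm (elem_op a b)"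
      if "mat_opnorm x \<le> 1" for x
      unfolding map_norm_def using that by (intro SUP_upper) simp
    \<comment> \<open>The zero matrix is admissible in the supremum, so \<open>map_norm\<close> is
      at least zero and \<open>m\<close> lies strictly above it.\<close>
    have "0 < m"
    proof -
      have "mat_opnorm (0 :: complex^2^2) \<le> 1" by (rule mat_opnorm_le) simp
      then have "ereal 0 \<le> map_norm (elem_op a b)"
        using map_norm_ge mat_opnorm_pos_le by (meson ereal_less_eq(3) order_trans)
      with m(1) show ?thesis by (metis ereal_less(2) le_less_trans zero_ereal_def)
    qed
    have "\<exists>s>0. \<exists>\<xi>. m * (norm \<xi>)\<^sup>2 < s * (norm (conj_transpose a *v \<xi>))\<^sup>2
          + (norm (conj_transpose b *v \<xi>))\<^sup>2 / s
        \<and> s * norm (conj_transpose a *v \<xi>) = norm (conj_transpose b *v \<xi>)"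
    proof (rule exists_balanced_vector[OF matrix_vector_mul_bounded_linear
          matrix_vector_mul_bounded_linear \<open>0 < m\<close>])
      fix s :: real assume "0 < s"
      then have "I \<le> N s" unfolding I_def by (intro cINF_lower bdd) simp
      with m(2) have "\<not> N s \<le> m" by simp
      then show "\<exists>\<xi>. m * (norm \<xi>)\<^sup>2 < s * (norm (conj_transpose a *v \<xi>))\<^sup>2
          + (norm (conj_transpose b *v \<xi>))\<^sup>2 / s"
        using mat_opnorm_row_le_iff[OF \<open>0 < s\<close>, of m a b] \<open>0 < m\<close> by (auto simp: N_def not_le)
    qed
    then obtain x where "mat_opnorm x \<le> 1" "m \<le> mat_opnorm (elem_op a b x)"
      using elem_op_attains[OF assms] by blast
    with map_norm_ge m(1) show False by (meson ereal_less_eq(3) not_le order_trans)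
  qed
  show ?thesis
    using upper lower map_norm_le_cb_norm[of "elem_op a b"] unfolding I_def N_def by auto
qed

end
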